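(* Let $X$ be a compact metric space and $\mathcal M(X)$ the space of Borel probability measures on $X$ with the weak$^*$ topology. Let $(\underline x^{(n)})_{n=1}^\infty\subset X^\infty$ be such that for each $n\in\mathbb N$ there is $\mu_n\in\mathcal M(X)$ for which $\underline x^{(n)}$ is generic. If $\underline x\in X^\infty$ and $\overline{\mathit{fk}}(\underline x,\underline x^{(n)})\to0$ as $n\to\infty$, then there exists $\mu\in\mathcal M(X)$ such that $\mu_n\to\mu$ in $\mathcal M(X)$ as $n\to\infty$ and $\underline x$ is generic for $\mu$.
   Context: Let $\rho$ be the metric of $X$; $X^\infty$ is the set of $X$-valued sequences indexed by $\mathbb N\cup\{0\}$. Feldman–Katok pseudometric: for $\underline x=(x_j),\underline z=(z_j)\in X^\infty$, $\delta>0$, $n\in\mathbb N$, an $(n,\delta)$-match is an order-preserving bijection $\pi\colon\mathcal D(\pi)\to\mathcal R(\pi)$ with $\mathcal D(\pi),\mathcal R(\pi)\subset\{0,\dots,n-1\}$ (possibly empty) and $\rho(x_i,z_{\pi(i)})<\delta$ for all $i\in\mathcal D(\pi)$; $|\pi|=|\mathcal D(\pi)|$. Put $\bar f_{n,\delta}(\underline x,\underline z)=1-\frac1n\max\{|\pi|:\pi\text{ is an }(n,\delta)\text{-match}\}$, $\bar f_\delta(\underline x,\underline z)=\limsup_{n\to\infty}\bar f_{n,\delta}(\underline x,\underline z)$, and $\overline{\mathit{fk}}(\underline x,\underline z)=\inf\{\delta>0:\bar f_\delta(\underline x,\underline z)<\delta\}$. A sequence $\underline x=(x_j)\in X^\infty$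 is generic for $\mu\in\mathcal M(X)$ if $\frac1n\sum_{j=0}^{n-1}\delta_{x_j}\to\mu$ in the weak$^*$ topology as $n\to\infty$. *)

theory Defs
  imports "HOL-Probability.Probability"
begin

definition prob_measures :: "'a::metric_space measure set" where
  "prob_measures = {M. prob_space M \<and> sets M = sets borel}"

text \<open>The weak-star topology on the Borel probability measures of a compact space: the coarsest
  topology making \<open>M \<mapsto> \<integral>f dM\<close> continuous for every continuous real function \<open>f\<close>. Boundedness of
  \<open>f\<close> is not required, so the definition is only meaningful when the underlying space is compact.\<close>

definition weak_star_topology :: "'a::metric_space measure topology" where
  "weak_star_topology = topology_generated_by
     {{M \<in> prob_measures. (\<integral>y. f y \<partial>M) \<in> U} | (f :: 'a \<Rightarrow> real) (U :: real set).
        continuous_on UNIV f \<and> open U}"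

lemma topspace_weak_star_topology [simp]: "topspace weak_star_topology = prob_measures"
proof -
  have "{M \<in> prob_measures. (\<integral>y. (0::real) \<partial>(M :: 'a measure)) \<in> UNIV} \<in>
     {{M \<in> prob_measures. (\<integral>y. f y \<partial>M) \<in> U} | (f :: 'a \<Rightarrow> real) (U :: real set).
        continuous_on UNIV f \<and> open U}"
    by (intro CollectI exI[of _ "\<lambda>_. 0"] exI[of _ UNIV]) auto
  then show ?thesis
    unfolding weak_star_topology_def topology_generated_by_topspace by auto
qed

lemma limitin_weak_star_topology_iff:
  fixes \<mu> :: "'a::metric_space measure"
  shows "limitin weak_star_topology M \<mu> F \<longleftrightarrow>
    \<mu> \<in> prob_measures \<and> (\<forall>\<^sub>F i in F. M i \<in> prob_measures) \<and>
    (\<forall>f :: 'a \<Rightarrow> real. continuous_on UNIV f \<longrightarrow> ((\<lambda>i. \<integral>y. f y \<partial>M i) \<longlongrightarrow> (\<integral>y. f y \<partial>\<mu>)) F)"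
    (is "?L \<longleftrightarrow> ?R")
proof
  assume L: ?L
  have \<mu>: "\<mu> \<in> prob_measures"
    using limitin_topspace[OF L] by simp
  have ev: "\<forall>\<^sub>F i in F. M i \<in> prob_measures \<and> (\<integral>y. f y \<partial>M i) \<in> U"
    if f: "continuous_on UNIV f" and U: "open U" "(\<integral>y. f y \<partial>\<mu>) \<in> U"
    for f :: "'a \<Rightarrow> real" and U
  proof -
    have "openin weak_star_topology {N \<in> prob_measures. (\<integral>y. f y \<partial>N) \<in> U}"
      unfolding weak_star_topology_def by (rule topology_generated_by_Basis) (use f U in blast)
    then show ?thesis
      using L \<mu> U unfolding limitin_def by auto
  qed
  show ?R
  proof (intro conjI allI impI \<mu>)
    show "\<forall>\<^sub>F i in F. M i \<in> prob_measures"
      using ev[of "\<lambda>_. 0" UNIV] by simp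
    fix f :: "'a \<Rightarrow> real" assume f: "continuous_on UNIV f"
    show "((\<lambda>i. \<integral>y. f y \<partial>M i) \<longlongrightarrow> (\<integral>y. f y \<partial>\<mu>)) F"
      by (rule topological_tendstoI) (rule eventually_mono[OF ev[OF f]], auto)
  qed
next
  assume R: ?R
  have "\<mu> \<in> U \<longrightarrow> (\<forall>\<^sub>F i in F. M i \<in> U)" if "openin weak_star_topology U" for U
    using that unfolding weak_star_topology_def openin_topology_generated_by_iff
  proof induction
    case (Basis s)
    then obtain f :: "'a \<Rightarrow> real" and V where
      s: "s = {N \<in> prob_measures. (\<integral>y. f y \<partial>N) \<in> V}" and f: "continuous_on UNIV f" and V: "open V"
      by blast
    show ?case
    proof
      assume "\<mu> \<in> s"
      then have "\<forall>\<^sub>F i in F. (\<integral>y. f y \<partial>M i) \<in> V"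
        using R f V s by (auto intro: topological_tendstoD)
      then show "\<forall>\<^sub>F i in F. M i \<in> s"
        using R unfolding s by (auto elim: eventually_elim2)
    qed
  next
    case (UN K)
    show ?case
    proof
      assume "\<mu> \<in> \<Union>K"
      then obtain k where k: "k \<in> K" "\<mu> \<in> k" by blast
      then have "\<forall>\<^sub>F i in F. M i \<in> k" using UN by blast
      then show "\<forall>\<^sub>F i in F. M i \<in> \<Union>K"
        by (rule eventually_mono) (use k in blast)
    qed
  next
    case (Int a b)
    then show ?case by (simp add: eventually_conj_iff)
  qed simp
  then show ?L
    using R by (auto simp: limitin_def)
qed

definition empirical_measure :: "(nat \<Rightarrow> 'a::metric_space) \<Rightarrow> nat \<Rightarrow> 'a measure" where
  "empirical_measure x n =
     measure_of UNIV (sets borel) (\<lambda>A. (\<Sum>j<n. emeasure (return borel (x j)) A) / of_nat n)"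

text \<open>\<^const>\<open>measure_of\<close> degenerates to the null measure unless its argument is countably additive;
  the next lemma shows that this does not happen here.\<close>

lemma emeasure_empirical_measure:
  assumes "A \<in> sets borel"
  shows "emeasure (empirical_measure x n) A = (\<Sum>j<n. emeasure (return borel (x j)) A) / of_nat n"
proof -
  have "countably_additive (sets borel)
      (\<lambda>A. (\<Sum>j<n. emeasure (return borel (x j)) A) / of_nat n)"
  proof (rule countably_additiveI)
    fix A :: "nat \<Rightarrow> 'a set"
    assume A: "range A \<subseteq> sets borel" "disjoint_family A"
    have "(\<Sum>i. (\<Sum>j<n. emeasure (return borel (x j)) (A i)) / of_nat n)
        = (\<Sum>i. \<Sum>j<n. emeasure (return borel (x j)) (A i)) / of_nat n"
      unfolding divide_ennreal_def by (rule ennreal_suminf_multc)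
    also have "(\<Sum>i. \<Sum>j<n. emeasure (return borel (x j)) (A i))
        = (\<Sum>j<n. \<Sum>i. emeasure (return borel (x j)) (A i))"
      by (rule suminf_sum) (rule summableI)
    also have "\<dots> = (\<Sum>j<n. emeasure (return borel (x j)) (\<Union>i. A i))"
      using A by (intro sum.cong refl suminf_emeasure) auto
    finally show "(\<Sum>i. (\<Sum>j<n. emeasure (return borel (x j)) (A i)) / of_nat n)
        = (\<Sum>j<n. emeasure (return borel (x j)) (\<Union>i. A i)) / of_nat n" .
  qed
  moreover have "positive (sets borel)
      (\<lambda>A. (\<Sum>j<n. emeasure (return borel (x j)) A) / of_nat n)"
    by (simp add: positive_def)
  moreover have "sigma_algebra UNIV (sets (borel :: 'a measure))"
    using sets.sigma_algebra_axioms[of "borel :: 'a measure"] by simp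
  ultimately show ?thesis
    unfolding empirical_measure_def using assms by (intro emeasure_measure_of_sigma)
qed

definition generic :: "(nat \<Rightarrow> 'a::metric_space) \<Rightarrow> 'a measure \<Rightarrow> bool" where
  "generic x \<mu> \<longleftrightarrow> limitin weak_star_topology (\<lambda>n. empirical_measure x n) \<mu> sequentially"

text \<open>A match is given by its domain \<open>D\<close>, its range \<open>R\<close> and a function \<open>\<pi>\<close> of which only the
  restriction to \<open>D\<close> matters.\<close>

definition is_match ::
  "nat \<Rightarrow> real \<Rightarrow> (nat \<Rightarrow> 'a::metric_space) \<Rightarrow> (nat \<Rightarrow> 'a) \<Rightarrow>
     nat set \<Rightarrow> nat set \<Rightarrow> (nat \<Rightarrow> nat) \<Rightarrow> bool" where
  "is_match n \<delta> x z D R \<pi> \<longleftrightarrow>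
     D \<subseteq> {..<n} \<and> R \<subseteq> {..<n} \<and> bij_betw \<pi> D R \<and> mono_on D \<pi> \<and>
     (\<forall>i\<in>D. dist (x i) (z (\<pi> i)) < \<delta>)"

definition fbar_n ::
  "nat \<Rightarrow> real \<Rightarrow> (nat \<Rightarrow> 'a::metric_space) \<Rightarrow> (nat \<Rightarrow> 'a) \<Rightarrow> real" where
  "fbar_n n \<delta> x z = 1 - 1 / real n * real (Max {card D | D R \<pi>. is_match n \<delta> x z D R \<pi>})"

definition fbar :: "real \<Rightarrow> (nat \<Rightarrow> 'a::metric_space) \<Rightarrow> (nat \<Rightarrow> 'a) \<Rightarrow> ereal" where
  "fbar \<delta> x z = limsup (\<lambda>n. ereal (fbar_n n \<delta> x z))"

definition fk :: "(nat \<Rightarrow> 'a::metric_space) \<Rightarrow> (nat \<Rightarrow> 'a) \<Rightarrow> real" where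
  "fk x z = Inf {\<delta>::real. \<delta> > 0 \<and> fbar \<delta> x z < ereal \<delta>}"

text \<open>The set under \<^const>\<open>Max\<close> is finite and nonempty, and the set under \<^const>\<open>Inf\<close> is nonempty
  and bounded below, so neither takes a junk value.\<close>

lemma finite_match_cards: "finite {card D | D R \<pi>. is_match n \<delta> x z D R \<pi>}"
proof (rule finite_subset)
  show "{card D | D R \<pi>. is_match n \<delta> x z D R \<pi>} \<subseteq> {..n}"
    using card_mono[of "{..<n}"] by (force simp: is_match_def)
qed simp

lemma zero_in_match_cards: "0 \<in> {card D | D R \<pi>. is_match n \<delta> x z D R \<pi>}"
  by (auto simp: is_match_def monotone_on_def intro!: exI[of _ "{}"])

lemma fk_set_nonempty: "2 \<in> {\<delta>::real. \<delta> > 0 \<and> fbar \<delta> x z < ereal \<delta>}"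
proof -
  have "fbar 2 x z \<le> 1"
    unfolding fbar_def by (rule Limsup_bounded) (simp add: fbar_n_def)
  also have "(1::ereal) < ereal 2" by simp
  finally show ?thesis by simp
qed

end

(* Along a match that leaves out a small proportion of indices, the Birkhoff sums of a uniformly
   continuous function f nearly agree. Hence the averages of f along x are Cauchy, and the integrals
   of f under mu_n have the same limit L f. The limit measure comes from the positive normalized
   functional L by Riesz representation: the outer measure of A is the infimum of sum_n L(g_n) over
   countable families of continuous g_n >= 0 with sum_n g_n >= 1 on A, and Caratheodory's theorem
   makes it a Borel measure. *)

theory Submission
  imports Defs
begin

section \<open>The Riesz representation theorem on a compact metric space\<close>

text \<open>A positive normalized linear functional on the continuous functions. \<open>L\<close> is
  total on the function type, but its values at discontinuous arguments are unconstrained, so each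
  use of linearity or positivity carries a continuity proof.\<close>

locale mean_functional =
  fixes L :: "('a::metric_space \<Rightarrow> real) \<Rightarrow> real"
  assumes compact_space: "compact (UNIV :: 'a set)"
    and add: "\<And>f g. \<lbrakk>continuous_on UNIV f; continuous_on UNIV g\<rbrakk> \<Longrightarrow> L (\<lambda>x. f x + g x) = L f + L g"
    and scale: "\<And>f c. continuous_on UNIV f \<Longrightarrow> L (\<lambda>x. c * f x) = c * L f"
    and nonneg: "\<And>f. \<lbrakk>continuous_on UNIV f; \<And>x. 0 \<le> f x\<rbrakk> \<Longrightarrow> 0 \<le> L f"
    and one: "L (\<lambda>_. 1) = 1"
begin

lemma const: "L (\<lambda>_. c) = c"
  using scale[of "\<lambda>_. 1" c] one by simp

lemma diff:
  assumes "continuous_on UNIV f" "continuous_on UNIV g"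
  shows "L (\<lambda>x. f x - g x) = L f - L g"
proof -
  have "L (\<lambda>x. f x + (-1) * g x) = L f + L (\<lambda>x. (-1) * g x)"
    by (intro add assms continuous_intros)
  also have "L (\<lambda>x. (-1) * g x) = (-1) * L g"
    by (intro scale assms)
  finally show ?thesis by simp
qed

lemma mono:
  assumes "continuous_on UNIV f" "continuous_on UNIV g" "\<And>x. f x \<le> g x"
  shows "L f \<le> L g"
  using nonneg[of "\<lambda>x. g x - f x"] diff[OF assms(2,1)] assms by (auto intro!: continuous_intros)

lemma sum:
  assumes "\<And>i. i \<in> I \<Longrightarrow> continuous_on UNIV (f i)"
  shows "L (\<lambda>x. \<Sum>i\<in>I. f i x) = (\<Sum>i\<in>I. L (f i))"
  using assms
proof (induction I rule: infinite_finite_induct)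
  case (insert i I)
  have "L (\<lambda>x. f i x + (\<Sum>i\<in>I. f i x)) = L (f i) + L (\<lambda>x. \<Sum>i\<in>I. f i x)"
    using insert.prems by (intro add continuous_on_sum) auto
  then show ?case using insert by simp
qed (auto simp: const)

section \<open>Outer measure of a positive functional\<close>

definition covers :: "(nat \<Rightarrow> 'a \<Rightarrow> real) \<Rightarrow> 'a set \<Rightarrow> bool" where
  "covers g A \<longleftrightarrow> (\<forall>n. continuous_on UNIV (g n)) \<and> (\<forall>n x. 0 \<le> g n x) \<and>
     (\<forall>x\<in>A. 1 \<le> (\<Sum>n. ennreal (g n x)))"

text \<open>A Daniell-type outer measure. Countable families make it countably subadditive, and
  pointwise sums in \<open>ennreal\<close> are allowed to diverge. For a cover every
  \<open>L (g n)\<close> is nonnegative, so \<open>ennreal\<close> truncates nothing.\<close>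

definition outer :: "'a set \<Rightarrow> ennreal" where
  "outer A = (INF g\<in>{g. covers g A}. \<Sum>n. ennreal (L (g n)))"

lemma outer_le: "covers g A \<Longrightarrow> outer A \<le> (\<Sum>n. ennreal (L (g n)))"
  unfolding outer_def by (intro INF_lower) simp

text \<open>Enumerating pairs by \<open>prod_decode\<close> turns a doubly indexed cover into a
  singly indexed one. Thus covers can be merged, as countable subadditivity requires, and members of
  a cover can be cut into countably many pieces, as in \<open>outer_split_closed\<close>.\<close>

lemma outer_le_2dimen:
  assumes "\<And>n k. continuous_on UNIV (g n k)" "\<And>n k x. 0 \<le> g n k x"
    and "\<And>x. x \<in> A \<Longrightarrow> 1 \<le> (\<Sum>n. \<Sum>k. ennreal (g n k x))"
  shows "outer A \<le> (\<Sum>n. \<Sum>k. ennreal (L (g n k)))"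
proof -
  define h where "h i = (case prod_decode i of (n, k) \<Rightarrow> g n k)" for i
  have *: "(\<Sum>i. ennreal (h i x)) = (\<Sum>n. \<Sum>k. ennreal (g n k x))" for x
    using suminf_ennreal_2dimen[of "\<lambda>n. \<Sum>k. ennreal (g n k x)" "\<lambda>(n, k). ennreal (g n k x)"]
    by (simp add: h_def case_prod_unfold)
  have **: "(\<Sum>i. ennreal (L (h i))) = (\<Sum>n. \<Sum>k. ennreal (L (g n k)))"
    using suminf_ennreal_2dimen[of "\<lambda>n. \<Sum>k. ennreal (L (g n k))" "\<lambda>(n, k). ennreal (L (g n k))"]
    by (simp add: h_def case_prod_unfold)
  have "covers h A"
    unfolding covers_def *
    using assms by (auto simp: h_def case_prod_unfold)
  from outer_le[OF this] show ?thesis by (simp add: **)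
qed

lemma outer_empty: "outer {} = 0"
proof -
  have "covers (\<lambda>_ _. 0) {}" by (simp add: covers_def)
  from outer_le[OF this] show ?thesis by (simp add: const)
qed

lemma outer_mono: "A \<subseteq> B \<Longrightarrow> outer A \<le> outer B"
  unfolding outer_def covers_def by (intro INF_superset_mono) auto

lemma outer_approx:
  assumes "outer A < top" "0 < e"
  obtains g where "covers g A" "(\<Sum>n. ennreal (L (g n))) \<le> outer A + ennreal e"
proof -
  have "outer A < outer A + ennreal e"
    using assms by (cases "outer A") (auto simp: ennreal_plus[symmetric] ennreal_lessI simp del: ennreal_plus)
  then obtain g where "covers g A" "(\<Sum>n. ennreal (L (g n))) < outer A + ennreal e"
    unfolding outer_def by (subst (asm) INF_less_iff) auto
  then show ?thesis using that by (auto intro: less_imp_le)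
qed

text \<open>Near-optimal covers of the \<open>A i\<close>, with excesses
  \<open>e * (1/2) ^ Suc i\<close> adding up to \<open>e\<close>, merge into one cover of the
  union.\<close>

lemma outer_UN_le: "outer (\<Union>i. A i) \<le> (\<Sum>i::nat. outer (A i))"
proof (cases "\<forall>i. outer (A i) < top")
  case True
  show ?thesis
  proof (rule ennreal_le_epsilon)
    fix e :: real assume e: "0 < e"
    have "\<exists>g. covers g (A i) \<and> (\<Sum>n. ennreal (L (g n))) \<le> outer (A i) + ennreal (e * (1/2) ^ Suc i)" for i
      by (rule outer_approx[of "A i" "e * (1/2) ^ Suc i"]) (use True e in auto)
    then obtain g where g: "\<And>i. covers (g i) (A i)"
      and le: "\<And>i. (\<Sum>n. ennreal (L (g i n))) \<le> outer (A i) + ennreal (e * (1/2) ^ Suc i)"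
      by metis
    have "outer (\<Union>i. A i) \<le> (\<Sum>i. \<Sum>n. ennreal (L (g i n)))"
    proof (rule outer_le_2dimen)
      fix x assume "x \<in> (\<Union>i. A i)"
      then obtain i where "x \<in> A i" by blast
      then have "1 \<le> (\<Sum>n. ennreal (g i n x))" using g[of i] by (auto simp: covers_def)
      also have "\<dots> \<le> (\<Sum>i. \<Sum>n. ennreal (g i n x))"
        using sum_le_suminf[of "\<lambda>i. \<Sum>n. ennreal (g i n x)" "{i}"] by simp
      finally show "1 \<le> (\<Sum>i. \<Sum>n. ennreal (g i n x))" .
    qed (use g in \<open>auto simp: covers_def\<close>)
    also have "\<dots> \<le> (\<Sum>i. outer (A i) + ennreal (e * (1/2) ^ Suc i))"
      by (intro suminf_le le) auto
    also have "\<dots> = (\<Sum>i. outer (A i)) + (\<Sum>i. ennreal (e * (1/2) ^ Suc i))"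
      by (rule suminf_add[symmetric]) auto
    also have "(\<Sum>i. ennreal (e * (1/2) ^ Suc i)) = ennreal e"
      using sums_mult[OF power_half_series, of e] e by (intro suminf_ennreal_eq) auto
    finally show "outer (\<Union>i. A i) \<le> (\<Sum>i. outer (A i)) + ennreal e" .
  qed
next
  case False
  then obtain i where "outer (A i) = top" by (meson less_top)
  then have "(\<Sum>i. outer (A i)) = top"
    using sum_le_suminf[of "\<lambda>i. outer (A i)" "{i}"] by (simp add: top_unique)
  then show ?thesis by simp
qed

lemma outer_measure_space_outer: "outer_measure_space UNIV outer"
  unfolding outer_measure_space_def positive_def increasing_def countably_subadditive_def
  using outer_empty outer_mono outer_UN_le by auto

lemma outer_subadd: "outer A \<le> outer (A \<inter> F) + outer (A - F)"
proof -
  \<comment> \<open>The power set serves as ambient sigma-algebra, so subadditivity is available for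
    arbitrary sets.\<close>
  interpret sigma_algebra UNIV "UNIV :: 'a set set"
    using sigma_algebra_Pow[of "UNIV :: 'a set"] by simp
  have "subadditive UNIV outer"
    using outer_measure_space_outer unfolding outer_measure_space_def
    by (intro countably_subadditive_subadditive) auto
  from subadditiveD[OF this, of "A \<inter> F" "A - F"] show ?thesis
    by (simp add: Int_Diff_Un Int_Diff_disjoint)
qed

text \<open>The functions \<open>h k\<close> below decrease to the indicator of \<open>F\<close>. Each \<open>h k\<close> splits a cover of
  \<open>A\<close> into a cover of \<open>A \<inter> F\<close> and a remainder; telescoping these remainders over \<open>k\<close> covers
  \<open>A - F\<close>.\<close>

lemma outer_split_closed:
  assumes F: "closed F" "F \<noteq> {}"
  shows "outer (A \<inter> F) + outer (A - F) \<le> outer A"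
proof -
  \<comment> \<open>\<open>infdist x {}\<close> is 0 by convention, so for empty \<open>F\<close>
    these functions would stay at 1; this is why \<open>F\<close> is assumed nonempty.\<close>
  define h where "h k x = max 0 (1 - real k * infdist x F)" for k x
  have h_cont: "continuous_on UNIV (h k)" for k
    unfolding h_def by (intro continuous_intros)
  have h0: "h 0 x = 1" for x by (simp add: h_def)
  have h_ge: "0 \<le> h k x" and h_le: "h k x \<le> 1" for k x
    by (auto simp: h_def infdist_nonneg)
  have h_dec: "h (Suc k) x \<le> h k x" for k x
    unfolding h_def by (intro max.mono diff_left_mono mult_right_mono infdist_nonneg) auto
  have hF: "h k x = 1" if "x \<in> F" for k x
    using that by (simp add: h_def)
  have h_out: "\<exists>k. h k x = 0" if "x \<notin> F" for x
  proof -
    have "infdist x F > 0" using that F by (simp add: infdist_pos_not_in_closed)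
    then obtain k where "1 < real k * infdist x F" using reals_Archimedean3 by blast
    then show ?thesis by (intro exI[of _ k]) (simp add: h_def)
  qed
  show ?thesis
    unfolding outer_def[of A]
  proof (rule INF_greatest)
    fix g assume "g \<in> {g. covers g A}"
    then have g: "\<And>n. continuous_on UNIV (g n)" "\<And>n x. 0 \<le> g n x"
      "\<And>x. x \<in> A \<Longrightarrow> 1 \<le> (\<Sum>n. ennreal (g n x))"
      by (auto simp: covers_def)
    \<comment> \<open>\<open>b K n\<close> is the mass that \<open>h K\<close> cuts off from
      \<open>g n\<close>. By \<open>split\<close>, for each fixed \<open>K\<close> these masses
      together with \<open>outer (A \<inter> F)\<close> stay below the cost of \<open>g\<close>; the
      supremum over \<open>K\<close> of their sums will bound \<open>outer (A - F)\<close>.\<close>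
    define b where "b K n = L (\<lambda>x. g n x * (1 - h K x))" for K n
    have b_nonneg: "0 \<le> b K n" for K n
      unfolding b_def using g h_le by (intro nonneg continuous_intros h_cont) auto
    have "outer (A \<inter> F) \<le> (\<Sum>n. ennreal (L (\<lambda>x. g n x * h K x)))" for K
      using g hF h_ge by (intro outer_le) (auto simp: covers_def intro!: continuous_intros h_cont)
    moreover have "ennreal (L (\<lambda>x. g n x * h K x)) + ennreal (b K n) = ennreal (L (g n))" for K n
    proof -
      have "L (\<lambda>x. g n x * h K x + g n x * (1 - h K x)) = L (\<lambda>x. g n x * h K x) + b K n"
        unfolding b_def by (intro add continuous_intros g h_cont)
      moreover have "0 \<le> L (\<lambda>x. g n x * h K x)"
        using g h_ge by (intro nonneg continuous_intros h_cont) auto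
      ultimately show ?thesis
        using b_nonneg[of K n] by (simp add: algebra_simps flip: ennreal_plus)
    qed
    ultimately have split: "outer (A \<inter> F) + (\<Sum>n. ennreal (b K n)) \<le> (\<Sum>n. ennreal (L (g n)))" for K
      using suminf_add[of "\<lambda>n. ennreal (L (\<lambda>x. g n x * h K x))" "\<lambda>n. ennreal (b K n)"]
      by (metis (no_types, lifting) add_right_mono suminf_cong summableI)
    have tele: "(\<Sum>k<K. g n x * (h k x - h (Suc k) x)) = g n x * (1 - h K x)" for n x K
      using sum_lessThan_telescope'[of "\<lambda>k. h k x" K] by (simp add: sum_distrib_left[symmetric] h0)
    have piece_nonneg: "0 \<le> L (\<lambda>x. g n x * (h k x - h (Suc k) x))" for n k
      using g h_dec by (intro nonneg continuous_intros h_cont) auto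
    have "outer (A - F) \<le> (\<Sum>n. \<Sum>k. ennreal (L (\<lambda>x. g n x * (h k x - h (Suc k) x))))"
    proof (rule outer_le_2dimen)
      fix x assume x: "x \<in> A - F"
      obtain K where K: "h K x = 0" using h_out x by blast
      have "1 \<le> (\<Sum>n. ennreal (g n x))" using g(3) x by blast
      \<comment> \<open>The stage \<open>K\<close> depends on \<open>x\<close>, which is harmless
        because the cover keeps the pieces for all \<open>k\<close>: once \<open>h K x = 0\<close>,
        the first \<open>K\<close> pieces telescope to \<open>g n x\<close>.\<close>
      also have "\<dots> \<le> (\<Sum>n. \<Sum>k. ennreal (g n x * (h k x - h (Suc k) x)))"
      proof (rule suminf_le)
        fix n
        have "ennreal (g n x) = (\<Sum>k<K. ennreal (g n x * (h k x - h (Suc k) x)))"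
          using g h_dec tele[where K=K and n=n and x=x] K by (subst sum_ennreal) auto
        also have "\<dots> \<le> (\<Sum>k. ennreal (g n x * (h k x - h (Suc k) x)))"
          by (rule sum_le_suminf) auto
        finally show "ennreal (g n x) \<le> (\<Sum>k. ennreal (g n x * (h k x - h (Suc k) x)))" .
      qed auto
      finally show "1 \<le> (\<Sum>n. \<Sum>k. ennreal (g n x * (h k x - h (Suc k) x)))" .
    qed (use g h_dec in \<open>auto intro!: continuous_intros h_cont\<close>)
    also have "\<dots> = (\<Sum>n. SUP K. ennreal (b K n))"
    proof (intro suminf_cong)
      fix n
      have "(\<Sum>k<K. ennreal (L (\<lambda>x. g n x * (h k x - h (Suc k) x)))) = ennreal (b K n)" for K
      proof -
        have "L (\<lambda>x. \<Sum>k<K. g n x * (h k x - h (Suc k) x))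
            = (\<Sum>k<K. L (\<lambda>x. g n x * (h k x - h (Suc k) x)))"
          by (intro sum continuous_intros g h_cont)
        then show ?thesis
          using piece_nonneg by (subst sum_ennreal) (auto simp: tele b_def)
      qed
      then show "(\<Sum>k. ennreal (L (\<lambda>x. g n x * (h k x - h (Suc k) x)))) = (SUP K. ennreal (b K n))"
        by (simp add: suminf_eq_SUP)
    qed
    \<comment> \<open>Monotone convergence for series: \<open>b K n\<close> increases with
      \<open>K\<close>, so the supremum can be moved outside the sum, where \<open>split\<close>
      applies to each \<open>K\<close>.\<close>
    also have "\<dots> = (SUP K. \<Sum>n. ennreal (b K n))"
    proof (rule ennreal_suminf_SUP_eq, rule incseq_SucI)
      fix n K
      show "ennreal (b K n) \<le> ennreal (b (Suc K) n)"
        unfolding b_def using g h_dec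
        by (intro ennreal_leI mono continuous_intros h_cont mult_left_mono) auto
    qed
    finally have "outer (A \<inter> F) + outer (A - F)
        \<le> outer (A \<inter> F) + (SUP K. \<Sum>n. ennreal (b K n))"
      by (rule add_left_mono)
    also have "\<dots> = (SUP K. outer (A \<inter> F) + (\<Sum>n. ennreal (b K n)))"
      by (rule ennreal_SUP_add_right) simp
    also have "\<dots> \<le> (\<Sum>n. ennreal (L (g n)))"
      by (rule SUP_least) (rule split)
    finally show "outer (A \<inter> F) + outer (A - F) \<le> (\<Sum>n. ennreal (L (g n)))" .
  qed
qed

section \<open>From the outer measure to a Borel probability measure\<close>

definition repr :: "'a measure" where
  "repr = measure_of UNIV (sets borel) outer"

lemma sets_repr [simp]: "sets repr = sets borel"
  unfolding repr_def using sets.sigma_sets_eq[of "borel :: 'a measure"] by simp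

lemma space_repr [simp]: "space repr = UNIV"
  by (simp add: repr_def)

text \<open>By Caratheodory, \<open>outer\<close> is countably additive on its lambda system, which
  contains the closed sets by \<open>outer_split_closed\<close> and hence all Borel sets. So the
  \<open>measure_of\<close> in \<open>repr\<close> does not degenerate to the null measure.\<close>

lemma emeasure_repr:
  assumes "A \<in> sets borel"
  shows "emeasure repr A = outer A"
proof -
  interpret P: sigma_algebra UNIV "UNIV :: 'a set set"
    using sigma_algebra_Pow[of "UNIV :: 'a set"] by simp
  let ?S = "lambda_system UNIV UNIV outer"
  have meas: "measure_space UNIV ?S outer"
    by (rule P.caratheodory_lemma[OF outer_measure_space_outer])
  have "F \<in> ?S" if "closed F" for F
  proof (cases "F = {}")
    case False
    then show ?thesis
      unfolding P.lambda_system_eq using outer_split_closed[OF that] outer_subadd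
      by (auto intro!: antisym)
  qed (use outer_empty in \<open>auto simp: P.lambda_system_eq\<close>)
  then have "sigma_sets UNIV (Collect closed) \<subseteq> ?S"
    using meas by (intro sigma_algebra.sigma_sets_subset) (auto simp: measure_space_def)
  moreover have "sets borel = sigma_sets UNIV (Collect (closed :: 'a set \<Rightarrow> bool))"
    by (simp add: borel_eq_closed)
  ultimately have sub: "sets borel \<subseteq> ?S" by simp
  have "countably_additive (sets borel) outer"
    using meas sub unfolding measure_space_def countably_additive_def by blast
  moreover have "positive (sets borel) outer"
    by (simp add: positive_def outer_empty)
  moreover have "sigma_algebra UNIV (sets (borel :: 'a measure))"
    using sets.sigma_algebra_axioms[of "borel :: 'a measure"] by simp
  ultimately show ?thesis
    unfolding repr_def using assms by (intro emeasure_measure_of_sigma)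
qed

text \<open>Padded with zeros, \<open>f\<close> is a cover of \<open>A\<close>. These upper bounds
  and the total mass one are all that the integral estimates use about the values of
  \<open>repr\<close>.\<close>

lemma emeasure_repr_le:
  assumes "A \<in> sets borel" "continuous_on UNIV f" "\<And>x. 0 \<le> f x" "\<And>x. x \<in> A \<Longrightarrow> 1 \<le> f x"
  shows "emeasure repr A \<le> ennreal (L f)"
proof -
  define g where "g n = (if n = 0 then f else (\<lambda>_. 0))" for n :: nat
  have *: "(\<Sum>n. ennreal (g n x)) = ennreal (f x)" for x
    using suminf_finite[of "{0}" "\<lambda>n. ennreal (g n x)"] by (simp add: g_def)
  have **: "(\<Sum>n. ennreal (L (g n))) = ennreal (L f)"
    using suminf_finite[of "{0}" "\<lambda>n. ennreal (L (g n))"] by (simp add: g_def const)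
  have "covers g A"
    unfolding covers_def * using assms by (auto simp: g_def)
  from outer_le[OF this] show ?thesis using assms by (simp add: emeasure_repr **)
qed

text \<open>The lower bound is a Dini argument. For \<open>c < 1\<close> the partial sums of a cover
  exceed \<open>c\<close> on open sets that exhaust the space; by compactness one finite partial sum
  is at least \<open>c\<close> everywhere, and applying \<open>L\<close> shows that the cover costs
  at least \<open>c\<close>. Then \<open>c\<close> tends to 1.\<close>

lemma outer_UNIV: "outer UNIV = 1"
proof (rule antisym)
  show "outer UNIV \<le> 1"
    using emeasure_repr_le[of UNIV "\<lambda>_. 1"] by (simp add: emeasure_repr one)
  show "1 \<le> outer UNIV"
    unfolding outer_def
  proof (rule INF_greatest)
    fix g assume "g \<in> {g. covers g UNIV}"
    then have g: "\<And>n. continuous_on UNIV (g n)" "\<And>n x. 0 \<le> g n x"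
      "\<And>x. 1 \<le> (\<Sum>n. ennreal (g n x))"
      by (auto simp: covers_def)
    have L_g: "0 \<le> L (g n)" for n using g by (intro nonneg) auto
    have "ennreal c \<le> (\<Sum>n. ennreal (L (g n)))" if c: "0 < c" "c < 1" for c
    proof -
      define U where "U N = {x. c < (\<Sum>n<N. g n x)}" for N
      have "open (U N)" for N
        unfolding U_def by (intro open_Collect_less continuous_intros g)
      moreover have "UNIV \<subseteq> (\<Union>N. U N)"
      proof
        fix x
        have "ennreal c < 1" using c by (simp add: ennreal_less_one_iff)
        also have "\<dots> \<le> (SUP N. \<Sum>n<N. ennreal (g n x))"
          using g(3)[of x] by (simp add: suminf_eq_SUP)
        finally have "ennreal c < (SUP N. \<Sum>n<N. ennreal (g n x))" .
        then obtain N where "ennreal c < (\<Sum>n<N. ennreal (g n x))"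
          by (auto simp: less_SUP_iff)
        then have "c < (\<Sum>n<N. g n x)"
          using g c by (subst (asm) sum_ennreal) (auto simp: ennreal_less_iff)
        then show "x \<in> (\<Union>N. U N)" by (auto simp: U_def)
      qed
      ultimately obtain I where I: "finite I" "UNIV \<subseteq> (\<Union>N\<in>I. U N)"
        using compactE_image[OF compact_space, of UNIV U] by auto
      \<comment> \<open>Since the \<open>g n\<close> are nonnegative, the partial sum up to
        \<open>M\<close> dominates those up to every \<open>N\<close> in \<open>I\<close>. The
        inserted 0 keeps \<open>Max\<close> away from the empty set.\<close>
      define M where "M = Max (insert 0 I)"
      have "c \<le> (\<Sum>n<M. g n x)" for x
      proof -
        obtain N where "N \<in> I" "x \<in> U N" using I by blast
        moreover then have "N \<le> M" using I by (simp add: M_def)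
        ultimately have "c < (\<Sum>n<N. g n x)" "(\<Sum>n<N. g n x) \<le> (\<Sum>n<M. g n x)"
          using g by (auto simp: U_def intro!: sum_mono2)
        then show ?thesis by simp
      qed
      then have "L (\<lambda>_. c) \<le> L (\<lambda>x. \<Sum>n<M. g n x)"
        by (intro mono continuous_intros g)
      then have "c \<le> (\<Sum>n<M. L (g n))" by (simp add: const sum g)
      then have "ennreal c \<le> (\<Sum>n<M. ennreal (L (g n)))"
        using L_g by (simp add: ennreal_leI sum_ennreal)
      also have "\<dots> \<le> (\<Sum>n. ennreal (L (g n)))" by (rule sum_le_suminf) auto
      finally show ?thesis .
    qed
    note le = this
    show "1 \<le> (\<Sum>n. ennreal (L (g n)))"
    proof (rule dense_le_bounded[of 0])
      fix w :: ennreal assume w: "0 < w" "w < 1"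
      then obtain c where "w = ennreal c" "0 \<le> c" by (cases w) auto
      then show "w \<le> (\<Sum>n. ennreal (L (g n)))" using w le[of c] by (auto simp: ennreal_less_one_iff)
    qed simp
  qed
qed

lemma prob_space_repr: "prob_space repr"
  by (rule prob_spaceI) (simp add: emeasure_repr outer_UNIV)

section \<open>Integration against the representing measure\<close>

lemma bounded_continuous:
  fixes f :: "'a \<Rightarrow> real"
  assumes "continuous_on UNIV f"
  obtains B where "B > 0" "\<And>x. \<bar>f x\<bar> \<le> B"
proof -
  have "bounded (range f)"
    using compact_continuous_image[OF assms compact_space] compact_imp_bounded by blast
  then show ?thesis using that by (auto simp: bounded_pos)
qed

lemma integrable_repr:
  fixes f :: "'a \<Rightarrow> real"
  assumes "continuous_on UNIV f"
  shows "integrable repr f"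
proof -
  interpret prob_space repr by (rule prob_space_repr)
  obtain B where "\<And>x. \<bar>f x\<bar> \<le> B" using bounded_continuous[OF assms] by blast
  moreover have "f \<in> borel_measurable repr"
    using borel_measurable_continuous_onI[OF assms] by (simp cong: measurable_cong_sets)
  ultimately show ?thesis by (intro integrable_const_bound[of _ B]) auto
qed

text \<open>Layer cake at integer levels: \<open>f\<close> is at most one plus the number of levels \<open>i + 1 \<le> f x\<close>,
  and equal to the sum of its slices between consecutive integers.\<close>

lemma integral_repr_le_add_one:
  assumes f: "continuous_on UNIV f" "\<And>x. 0 \<le> f x"
  shows "(\<integral>x. f x \<partial>repr) \<le> 1 + L f"
proof -
  interpret prob_space repr by (rule prob_space_repr)
  obtain B where B: "\<And>x. \<bar>f x\<bar> \<le> B" using bounded_continuous[OF f(1)] by blast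
  obtain N :: nat where "B \<le> real N" using real_arch_simple by blast
  with B have fN: "f x \<le> real N" for x by (meson abs_le_D1 order_trans)
  define s where "s i x = max 0 (min 1 (f x - real i))" for i x
  have s_cont: "continuous_on UNIV (s i)" for i
    unfolding s_def by (intro continuous_intros f)
  have "(\<Sum>i<n. s i x) = min (f x) (real n)" for n x
    using f(2)[of x] by (induction n) (auto simp: s_def)
  then have s_sum: "(\<Sum>i<N. s i x) = f x" for x using fN[of x] by simp
  define S where "S i = {x. real i + 1 \<le> f x}" for i
  have S: "S i \<in> sets borel" for i
    unfolding S_def by (intro borel_closed closed_Collect_le continuous_intros f)
  \<comment> \<open>Raising the cap from \<open>n + 1\<close> to \<open>n + 2\<close> adds at most
    one, and only where \<open>f x\<close> reaches \<open>n + 1\<close>, that is on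
    \<open>S n\<close>. The leading 1 pays for the part of \<open>f\<close> below height
    one.\<close>
  have "min (f x) (real n + 1) \<le> 1 + (\<Sum>i<n. indicator (S i) x)" for n x
  proof (induction n)
    case (Suc n)
    have "min (f x) (real (Suc n) + 1) \<le> min (f x) (real n + 1) + indicator (S n) x"
      by (auto simp: S_def indicator_def)
    with Suc show ?case by simp
  qed simp
  note levels = this
  have f_le: "f x \<le> 1 + (\<Sum>i<N. indicator (S i) x)" for x
    using levels[of x N] fN[of x] by linarith
  have int: "integrable repr (indicator (S i) :: 'a \<Rightarrow> real)" for i
    using S[of i] by (auto intro!: integrable_real_indicator simp: less_top[symmetric])
  have "(\<integral>x. f x \<partial>repr) \<le> (\<integral>x. 1 + (\<Sum>i<N. indicator (S i) x) \<partial>repr)"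
    by (intro integral_mono f_le integrable_repr f Bochner_Integration.integrable_add
        Bochner_Integration.integrable_sum int) simp
  also have "\<dots> = 1 + (\<Sum>i<N. measure repr (S i))"
    using S by (subst Bochner_Integration.integral_add)
      (auto intro!: Bochner_Integration.integrable_sum int simp: Bochner_Integration.integral_sum[OF int] prob_space[simplified])
  also have "(\<Sum>i<N. measure repr (S i)) \<le> (\<Sum>i<N. L (s i))"
  proof (rule sum_mono)
    fix i
    have "0 \<le> L (s i)" by (intro nonneg s_cont) (simp add: s_def)
    \<comment> \<open>On \<open>S i\<close> the slice \<open>s i\<close> has its full height 1, so
      it is a continuous majorant of the indicator.\<close>
    moreover have "emeasure repr (S i) \<le> ennreal (L (s i))"
      by (intro emeasure_repr_le S s_cont) (auto simp: s_def S_def)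
    ultimately show "measure repr (S i) \<le> L (s i)"
      by (simp add: emeasure_eq_measure)
  qed
  also have "\<dots> = L f" using sum[of "{..<N}" s, OF s_cont] by (simp add: s_sum)
  finally show ?thesis by simp
qed

text \<open>The additive error 1 of the preceding estimate does not grow under scaling: applied to
  \<open>m * (f + B)\<close> and divided by \<open>m\<close>, it becomes \<open>1 / m\<close>. The
  shift by \<open>B\<close> ensures nonnegativity and cancels, since the integral and
  \<open>L\<close> agree on constants.\<close>

lemma integral_repr_le:
  assumes f: "continuous_on UNIV f"
  shows "(\<integral>x. f x \<partial>repr) \<le> L f"
proof -
  interpret prob_space repr by (rule prob_space_repr)
  obtain B where B: "\<And>x. \<bar>f x\<bar> \<le> B" using bounded_continuous[OF f] by blast
  have "0 \<le> f x + B" for x using B[of x] by linarith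
  then have "(\<integral>x. real m * (f x + B) \<partial>repr) \<le> 1 + L (\<lambda>x. real m * (f x + B))" for m
    by (intro integral_repr_le_add_one continuous_intros f) auto
  moreover have "L (\<lambda>x. real m * (f x + B)) = real m * (L f + B)" for m
    using scale[of "\<lambda>x. f x + B" "real m"] add[of f "\<lambda>_. B"] f
    by (simp add: const continuous_intros)
  moreover have "(\<integral>x. real m * (f x + B) \<partial>repr) = real m * ((\<integral>x. f x \<partial>repr) + B)" for m
    using integrable_repr[OF f] prob_space by (simp add: Bochner_Integration.integral_add)
  ultimately have *: "real m * ((\<integral>x. f x \<partial>repr) - L f) \<le> 1" for m
    by (simp add: algebra_simps)
  show ?thesis
  proof (rule ccontr)
    assume "\<not> ?thesis"
    then obtain m where "1 < real m * ((\<integral>x. f x \<partial>repr) - L f)"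
      using reals_Archimedean3[of "(\<integral>x. f x \<partial>repr) - L f"] by auto
    with *[of m] show False by simp
  qed
qed

text \<open>The one-sided bound for \<open>-f\<close> is the reverse bound for
  \<open>f\<close>.\<close>

lemma integral_repr:
  assumes f: "continuous_on UNIV f"
  shows "(\<integral>x. f x \<partial>repr) = L f"
proof (rule antisym)
  have "(\<integral>x. (-1) * f x \<partial>repr) \<le> L (\<lambda>x. (-1) * f x)"
    by (intro integral_repr_le continuous_intros f)
  also have "L (\<lambda>x. (-1) * f x) = (-1) * L f"
    by (rule scale[OF f])
  finally show "L f \<le> (\<integral>x. f x \<partial>repr)" by simp
qed (rule integral_repr_le[OF f])

end

section \<open>Averages along a sequence\<close>

definition avg :: "('a \<Rightarrow> real) \<Rightarrow> (nat \<Rightarrow> 'a) \<Rightarrow> nat \<Rightarrow> real" where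
  "avg f x n = (\<Sum>j<n. f (x j)) / real n"

text \<open>As the image of a uniform distribution, the empirical measure inherits total mass one
  and the formula for integrals. The uniform distribution lives on a nonempty set, hence
  \<open>n > 0\<close>; at \<open>n = 0\<close> the empirical measure is null.\<close>

lemma empirical_measure_eq_distr:
  fixes x :: "nat \<Rightarrow> 'a::metric_space"
  assumes "n > 0"
  shows "empirical_measure x n = distr (measure_pmf (pmf_of_set {..<n})) borel x"
proof (rule measure_eqI)
  show s: "sets (empirical_measure x n) = sets (distr (measure_pmf (pmf_of_set {..<n})) borel x)"
    unfolding empirical_measure_def using sets.sigma_sets_eq[of "borel :: 'a measure"] by simp
  fix A assume "A \<in> sets (empirical_measure x n)"
  then have A: "A \<in> sets borel" using s by simp
  have "emeasure (measure_pmf (pmf_of_set {..<n})) (x -` A)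
      = (\<integral>\<^sup>+j. indicator A (x j) \<partial>measure_pmf (pmf_of_set {..<n}))"
    by (subst nn_integral_indicator[symmetric]) (auto simp del: nn_integral_indicator
        simp: indicator_def intro!: nn_integral_cong)
  also have "\<dots> = (\<Sum>j<n. indicator A (x j)) / of_nat n"
    using assms by (subst nn_integral_pmf_of_set) (auto simp: lessThan_empty_iff ennreal_of_nat_eq_real_of_nat)
  finally show "emeasure (empirical_measure x n) A
      = emeasure (distr (measure_pmf (pmf_of_set {..<n})) borel x) A"
    using A by (simp add: emeasure_empirical_measure emeasure_distr)
qed

lemma integral_empirical_measure:
  fixes f :: "'a::metric_space \<Rightarrow> real"
  assumes "n > 0" "continuous_on UNIV f"
  shows "(\<integral>y. f y \<partial>empirical_measure x n) = avg f x n"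
  using assms borel_measurable_continuous_onI[OF assms(2)]
  by (simp add: empirical_measure_eq_distr integral_distr integral_pmf_of_set avg_def lessThan_empty_iff)

lemma empirical_measure_prob: "n > 0 \<Longrightarrow> empirical_measure x n \<in> prob_measures"
  unfolding prob_measures_def
  by (simp add: empirical_measure_eq_distr measure_pmf.prob_space_distr)

text \<open>Replaces empirical measures by real averages. The null measure at \<open>n = 0\<close>
  does no harm, since convergence concerns only large \<open>n\<close>.\<close>

lemma generic_iff:
  "generic x \<mu> \<longleftrightarrow> \<mu> \<in> prob_measures \<and>
    (\<forall>f. continuous_on UNIV f \<longrightarrow> avg f x \<longlonglongrightarrow> (\<integral>y. f y \<partial>\<mu>))"
proof -
  have "eventually (\<lambda>n. empirical_measure x n \<in> prob_measures) sequentially"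
    using eventually_gt_at_top[of 0] by (rule eventually_mono) (rule empirical_measure_prob)
  moreover have "(\<lambda>n. \<integral>y. f y \<partial>empirical_measure x n) \<longlonglongrightarrow> l \<longleftrightarrow> avg f x \<longlonglongrightarrow> l"
    if "continuous_on UNIV f" for f l
    by (rule tendsto_cong, rule eventually_mono[OF eventually_gt_at_top[of 0]])
      (simp add: integral_empirical_measure that)
  ultimately show ?thesis unfolding generic_def limitin_weak_star_topology_iff by auto
qed

section \<open>Matches and averages\<close>

lemma fbar_n_attained:
  obtains D R \<pi> where "is_match n \<delta> x z D R \<pi>" "fbar_n n \<delta> x z = 1 - real (card D) / real n"
proof -
  have "Max {card D | D R \<pi>. is_match n \<delta> x z D R \<pi>} \<in> {card D | D R \<pi>. is_match n \<delta> x z D R \<pi>}"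
    using finite_match_cards[of n \<delta> x z] zero_in_match_cards[of n \<delta> x z] by (intro Max_in) auto
  then show ?thesis using that by (auto simp: fbar_n_def)
qed

text \<open>Each matched pair changes the sum by at most \<open>e\<close>. Outside the match either
  sequence has \<open>n - card D\<close> indices, each contributing at most \<open>B\<close>; after
  division by \<open>n\<close> these two remainders give the term with
  \<open>fbar_n\<close>.\<close>

lemma avg_diff_le_match:
  fixes f :: "'a::metric_space \<Rightarrow> real"
  assumes n: "n > 0" and B: "\<And>y. \<bar>f y\<bar> \<le> B"
    and unif: "\<And>y w. dist y w < \<delta> \<Longrightarrow> \<bar>f y - f w\<bar> \<le> e"
    and e: "0 \<le> e"
  shows "\<bar>avg f x n - avg f z n\<bar> \<le> e + 2 * B * fbar_n n \<delta> x z"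
proof -
  obtain D R \<pi> where m: "is_match n \<delta> x z D R \<pi>" and fb: "fbar_n n \<delta> x z = 1 - real (card D) / real n"
    by (rule fbar_n_attained)
  have sub: "D \<subseteq> {..<n}" "R \<subseteq> {..<n}" and bij: "bij_betw \<pi> D R"
    and close: "\<And>i. i \<in> D \<Longrightarrow> dist (x i) (z (\<pi> i)) < \<delta>"
    using m by (auto simp: is_match_def)
  have cD: "card D \<le> n" using card_mono[OF _ sub(1)] by simp
  have rest: "\<bar>\<Sum>j\<in>{..<n} - E. f (y j)\<bar> \<le> (real n - real (card E)) * B"
    if "E \<subseteq> {..<n}" for y E
  proof -
    have "\<bar>\<Sum>j\<in>{..<n} - E. f (y j)\<bar> \<le> (\<Sum>j\<in>{..<n} - E. B)"
      using B by (intro order_trans[OF sum_abs] sum_mono)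
    then show ?thesis
      using that card_mono[OF _ that] finite_subset[OF that] by (simp add: card_Diff_subset of_nat_diff)
  qed
  have split: "(\<Sum>j<n. f (y j)) = (\<Sum>j\<in>E. f (y j)) + (\<Sum>j\<in>{..<n} - E. f (y j))"
    if "E \<subseteq> {..<n}" for y E
    using sum.subset_diff[OF that, of "\<lambda>j. f (y j)"] by simp
  have "(\<Sum>j\<in>R. f (z j)) = (\<Sum>i\<in>D. f (z (\<pi> i)))"
    using sum.reindex_bij_betw[OF bij, of "\<lambda>j. f (z j)"] by simp
  then have "(\<Sum>i\<in>D. f (x i)) - (\<Sum>j\<in>R. f (z j)) = (\<Sum>i\<in>D. f (x i) - f (z (\<pi> i)))"
    by (simp add: sum_subtractf)
  also have "\<bar>\<dots>\<bar> \<le> (\<Sum>i\<in>D. e)"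
    using unif close by (intro order_trans[OF sum_abs] sum_mono) auto
  also have "\<dots> \<le> real n * e" using cD e by (simp add: mult_right_mono)
  finally have match: "\<bar>(\<Sum>i\<in>D. f (x i)) - (\<Sum>j\<in>R. f (z j))\<bar> \<le> real n * e" .
  have cR: "card R = card D" using bij_betw_same_card[OF bij] by simp
  have "\<bar>(\<Sum>j<n. f (x j)) - (\<Sum>j<n. f (z j))\<bar> \<le> real n * e + 2 * ((real n - real (card D)) * B)"
    using match rest[OF sub(1), of x] rest[OF sub(2), of z, unfolded cR]
      split[OF sub(1), of x] split[OF sub(2), of z] by linarith
  also have "\<dots> = real n * (e + 2 * B * fbar_n n \<delta> x z)"
    using n by (simp add: fb field_simps)
  finally have "\<bar>(\<Sum>j<n. f (x j)) - (\<Sum>j<n. f (z j))\<bar> \<le> real n * (e + 2 * B * fbar_n n \<delta> x z)" .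
  moreover have "avg f x n - avg f z n = ((\<Sum>j<n. f (x j)) - (\<Sum>j<n. f (z j))) / real n"
    by (simp add: avg_def diff_divide_distrib)
  ultimately show ?thesis using n by (simp add: abs_divide pos_divide_le_eq mult.commute)
qed

text \<open>In \<open>fk\<close> one number bounds both the match radius and the unmatched
  proportion. The infimum yields such a \<delta> below \<eta>, and a strict bound on a limsup holds
  for the terms from some index on.\<close>

lemma fk_less_imp_fbar_n_less:
  assumes "fk x z < \<eta>"
  obtains \<delta> where "0 < \<delta>" "\<delta> < \<eta>" "eventually (\<lambda>n. fbar_n n \<delta> x z < \<delta>) sequentially"
proof -
  obtain \<delta> where \<delta>: "0 < \<delta>" "fbar \<delta> x z < ereal \<delta>" "\<delta> < \<eta>"
    using cInf_lessD[of "{\<delta>::real. \<delta> > 0 \<and> fbar \<delta> x z < ereal \<delta>}" \<eta>] assms fk_set_nonempty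
    unfolding fk_def by blast
  then have "eventually (\<lambda>n. ereal (fbar_n n \<delta> x z) < ereal \<delta>) sequentially"
    unfolding fbar_def by (intro Limsup_lessD)
  then show ?thesis using that \<delta> by simp
qed

lemma fk_tendsto_0_imp_avg_close:
  fixes f :: "'a::metric_space \<Rightarrow> real"
  assumes comp: "compact (UNIV :: 'a set)" and f: "continuous_on UNIV f"
    and lim: "(\<lambda>k. fk x (xs k)) \<longlonglongrightarrow> 0" and e: "0 < e"
  shows "eventually (\<lambda>k. eventually (\<lambda>n. \<bar>avg f x n - avg f (xs k) n\<bar> < e) sequentially) sequentially"
proof -
  obtain B where B: "B > 0" "\<And>y. \<bar>f y\<bar> \<le> B"
    using compact_imp_bounded[OF compact_continuous_image[OF f comp]] by (auto simp: bounded_pos)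
  have "uniformly_continuous_on UNIV f" by (rule compact_uniformly_continuous[OF f comp])
  then obtain d where d: "d > 0" "\<And>y w. dist y w < d \<Longrightarrow> \<bar>f y - f w\<bar> \<le> e / 2"
    unfolding uniformly_continuous_on_def using half_gt_zero[OF e]
    by (metis UNIV_I dist_commute dist_real_def less_imp_le)
  \<comment> \<open>The bound \<open>d\<close> puts matched points within the modulus of continuity
    for \<open>e / 2\<close>; the bound \<open>e / (4 * B)\<close> keeps the unmatched part,
    weighted by \<open>2 * B\<close>, below the other \<open>e / 2\<close>.\<close>
  define \<eta> where "\<eta> = min d (e / (4 * B))"
  have \<eta>: "\<eta> > 0" "\<eta> \<le> d" "\<eta> \<le> e / (4 * B)" using d e B by (auto simp: \<eta>_def)
  have "eventually (\<lambda>k. fk x (xs k) < \<eta>) sequentially"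
    using order_tendstoD(2)[OF lim \<eta>(1)] .
  then show ?thesis
  proof (rule eventually_mono)
    fix k assume "fk x (xs k) < \<eta>"
    then obtain \<delta> where \<delta>: "0 < \<delta>" "\<delta> < \<eta>"
      and ev: "eventually (\<lambda>n. fbar_n n \<delta> x (xs k) < \<delta>) sequentially"
      by (rule fk_less_imp_fbar_n_less)
    show "eventually (\<lambda>n. \<bar>avg f x n - avg f (xs k) n\<bar> < e) sequentially"
      using ev eventually_gt_at_top[of 0]
    proof eventually_elim
      case (elim n)
      have "\<bar>avg f x n - avg f (xs k) n\<bar> \<le> e / 2 + 2 * B * fbar_n n \<delta> x (xs k)"
        using elim B d \<delta> \<eta> e by (intro avg_diff_le_match) auto
      also have "\<dots> < e / 2 + 2 * B * (e / (4 * B))"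
        using elim B \<delta> \<eta> by (intro add_strict_left_mono mult_strict_left_mono) auto
      also have "\<dots> = e" using B by simp
      finally show ?case .
    qed
  qed
qed

section \<open>Interchange of limits and the limit functional\<close>

text \<open>For late \<open>k\<close>, all late \<open>a n\<close> lie within \<open>e\<close> of
  \<open>c k\<close>. One such \<open>k\<close> for each \<open>e\<close> makes \<open>a\<close>
  Cauchy, and letting \<open>n\<close> tend to infinity brings \<open>c k\<close> close to its
  limit. The convergence of \<open>b k\<close> is asked only eventually because the index 0 carries
  no measure in the application.\<close>

lemma double_limit_interchange:
  fixes a :: "nat \<Rightarrow> real" and b :: "nat \<Rightarrow> nat \<Rightarrow> real"
  assumes close: "\<And>e. 0 < e \<Longrightarrow>
      eventually (\<lambda>k. eventually (\<lambda>n. \<bar>a n - b k n\<bar> < e) sequentially) sequentially"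
    and lim: "eventually (\<lambda>k. b k \<longlonglongrightarrow> c k) sequentially"
  obtains l where "a \<longlonglongrightarrow> l" "c \<longlonglongrightarrow> l"
proof -
  have ac: "eventually (\<lambda>k. eventually (\<lambda>n. \<bar>a n - c k\<bar> < e) sequentially) sequentially"
    if "0 < e" for e
    using close[OF half_gt_zero[OF that]] lim
  proof eventually_elim
    case (elim k)
    have "eventually (\<lambda>n. dist (b k n) (c k) < e / 2) sequentially"
      using elim(2) that by (intro tendstoD) auto
    with elim(1) show ?case
      by eventually_elim (auto simp: dist_real_def abs_if split: if_splits)
  qed
  have "Cauchy a"
    unfolding Cauchy_altdef2
  proof (intro allI impI)
    fix e :: real assume e: "0 < e"
    obtain k where "eventually (\<lambda>n. \<bar>a n - c k\<bar> < e / 2) sequentially"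
      using eventually_happens[OF ac[OF half_gt_zero[OF e]]] by auto
    then obtain N where N: "\<And>n. n \<ge> N \<Longrightarrow> \<bar>a n - c k\<bar> < e / 2"
      by (auto simp: eventually_sequentially)
    have "dist (a n) (a N) < e" if "n \<ge> N" for n
      using N[OF that] N[of N] unfolding dist_real_def by linarith
    then show "\<exists>N. \<forall>n\<ge>N. dist (a n) (a N) < e" by blast
  qed
  then obtain l where l: "a \<longlonglongrightarrow> l" using Cauchy_convergent convergent_def by blast
  have "c \<longlonglongrightarrow> l"
  proof (rule tendstoI)
    fix e :: real assume e: "0 < e"
    show "eventually (\<lambda>k. dist (c k) l < e) sequentially"
      using ac[OF half_gt_zero[OF e]]
    proof (rule eventually_mono)
      fix k assume "eventually (\<lambda>n. \<bar>a n - c k\<bar> < e / 2) sequentially"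
      then have "\<bar>l - c k\<bar> \<le> e / 2"
        using l by (intro tendsto_upperbound[of "\<lambda>n. \<bar>a n - c k\<bar>" _ sequentially])
          (auto intro!: tendsto_intros elim: eventually_mono)
      then show "dist (c k) l < e" using e unfolding dist_real_def by linarith
    qed
  qed
  with l show ?thesis using that by blast
qed

text \<open>Linearity, positivity and normalization pass from averages to limits. \<open>lim\<close>
  is meaningful only where the averages converge, which is assured exactly for the continuous
  functions that the locale speaks of.\<close>

lemma mean_functional_lim_avg:
  fixes x :: "nat \<Rightarrow> 'a::metric_space"
  assumes "compact (UNIV :: 'a set)"
    and conv: "\<And>f. continuous_on UNIV f \<Longrightarrow> convergent (avg f x)"
  shows "mean_functional (\<lambda>f. lim (avg f x))"
proof
  have lim: "avg f x \<longlonglongrightarrow> lim (avg f x)" if "continuous_on UNIV f" for f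
    using conv[OF that] by (simp add: convergent_LIMSEQ_iff)
  show "compact (UNIV :: 'a set)" by fact
  show "lim (avg (\<lambda>y. f y + g y) x) = lim (avg f x) + lim (avg g x)"
    if "continuous_on UNIV f" "continuous_on UNIV g" for f g
  proof (rule limI)
    have "avg (\<lambda>y. f y + g y) x = (\<lambda>n. avg f x n + avg g x n)"
      by (simp add: avg_def fun_eq_iff sum.distrib add_divide_distrib)
    then show "avg (\<lambda>y. f y + g y) x \<longlonglongrightarrow> lim (avg f x) + lim (avg g x)"
      using lim that by (auto intro: tendsto_add)
  qed
  show "lim (avg (\<lambda>y. c * f y) x) = c * lim (avg f x)" if "continuous_on UNIV f" for f c
  proof (rule limI)
    have "avg (\<lambda>y. c * f y) x = (\<lambda>n. c * avg f x n)"
      by (simp add: avg_def fun_eq_iff sum_distrib_left)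
    then show "avg (\<lambda>y. c * f y) x \<longlonglongrightarrow> c * lim (avg f x)"
      using lim that by (auto intro: tendsto_mult_left)
  qed
  show "0 \<le> lim (avg f x)" if "continuous_on UNIV f" "\<And>y. 0 \<le> f y" for f
    using that by (intro LIMSEQ_le_const[OF lim]) (auto simp: avg_def intro!: divide_nonneg_nonneg sum_nonneg)
  show "lim (avg (\<lambda>_. 1) x) = 1"
  proof (rule limI)
    show "avg (\<lambda>_. 1) x \<longlonglongrightarrow> 1"
      by (rule tendsto_eventually, rule eventually_mono[OF eventually_gt_at_top[of 0]])
        (simp add: avg_def)
  qed
qed

theorem theorem5p7:
  fixes xs :: "nat \<Rightarrow> nat \<Rightarrow> 'a::metric_space"
    and \<mu>s :: "nat \<Rightarrow> 'a measure"
    and x :: "nat \<Rightarrow> 'a"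
  assumes "compact (UNIV :: 'a set)"
    and "\<And>n. n \<ge> 1 \<Longrightarrow> \<mu>s n \<in> prob_measures"
    and "\<And>n. n \<ge> 1 \<Longrightarrow> generic (xs n) (\<mu>s n)"
    and "(\<lambda>n. fk x (xs n)) \<longlonglongrightarrow> 0"
  shows "\<exists>\<mu> \<in> prob_measures.
           limitin weak_star_topology \<mu>s \<mu> sequentially \<and> generic x \<mu>"
proof -
  \<comment> \<open>The limit is shared by both sequences, so a single measure will serve for both
    conclusions.\<close>
  have lims: "\<exists>l. avg f x \<longlonglongrightarrow> l \<and> (\<lambda>k. \<integral>y. f y \<partial>\<mu>s k) \<longlonglongrightarrow> l"
    if f: "continuous_on UNIV f" for f
  proof -
    have "eventually (\<lambda>k. avg f (xs k) \<longlonglongrightarrow> (\<integral>y. f y \<partial>\<mu>s k)) sequentially"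
      using eventually_ge_at_top[of 1]
      by (rule eventually_mono) (use assms(3) f in \<open>simp add: generic_iff\<close>)
    from double_limit_interchange[OF fk_tendsto_0_imp_avg_close[OF assms(1) f assms(4)] this]
    show ?thesis by blast
  qed
  then have "convergent (avg f x)" if "continuous_on UNIV f" for f
    using that by (auto simp: convergent_def)
  then interpret mean_functional "\<lambda>f. lim (avg f x)"
    by (rule mean_functional_lim_avg[OF assms(1)])
  have repr: "repr \<in> prob_measures"
    by (simp add: prob_measures_def prob_space_repr)
  \<comment> \<open>By uniqueness of limits the common \<open>l\<close> is
    \<open>lim (avg f x)\<close>, which \<open>integral_repr\<close> identifies with the integral
    against \<open>repr\<close>.\<close>
  have "avg f x \<longlonglongrightarrow> (\<integral>y. f y \<partial>repr) \<and> (\<lambda>k. \<integral>y. f y \<partial>\<mu>s k) \<longlonglongrightarrow> (\<integral>y. f y \<partial>repr)"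
    if f: "continuous_on UNIV f" for f
    using lims[OF f] limI[of "avg f x"] by (auto simp: integral_repr[OF f])
  moreover have "eventually (\<lambda>k. \<mu>s k \<in> prob_measures) sequentially"
    using eventually_ge_at_top[of 1] by (rule eventually_mono) (rule assms(2))
  ultimately show ?thesis
    using repr by (intro bexI[of _ repr]) (auto simp: limitin_weak_star_topology_iff generic_iff)
qed

end
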